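(* Let $\mu,\nu\in\mathcal P(\mathbb R)$ satisfy $\mu\le_{\rm cx}\nu$. There exist $\pi\in\mathcal M(\mu,\nu)$ and a Borel function $h:\mathbb R\to\mathbb R$ such that $\pi(T_{\rm rg}\cup T_{\rm atom})=1$, where (i) $T_{\rm rg}=\{(h(y),y):y\in\mathbb R\}$; (ii) $T_{\rm atom}=\{(x,y)\in\mathbb R^2:\nu(\{y\})>0\}$. In particular, if $\nu$ is atomless, then $\pi$ is a Monge martingale transport, i.e. $\pi\in\mathcal M_M(\mu,\nu)$.
   Context: $\mathcal P(\mathbb R)$ is the set of Borel probability measures on $\mathbb R$ with finite first moment. $\mu\le_{\rm cx}\nu$ (convex order) means $\int\phi\,d\mu\le\int\phi\,d\nu$ for every convex $\phi:\mathbb R\to\mathbb R$. $\mathcal M(\mu,\nu)$ is the set of martingale transports: laws $\pi$ on $\mathbb R^2$ of random vectors $(X,Y)$ with $X\sim\mu$, $Y\sim\nu$ and $\mathbb E[Y|X]=X$ a.s. A (backward) Monge martingale transport is an element of $\mathcal M_M(\mu,\nu)$, the set of those $\pi\in\mathcal M(\mu,\nu)$ of the form $\pi=(f,\mathrm{id}_{\mathbb R})_{\#}\nu$ for some Borel $f:\mathbb R\to\mathbb R$ (i.e. $X=f(Y)$ a.s.). *)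

theory Defs
  imports "HOL-Probability.Probability"
begin

definition P1 :: "real measure set" where
  "P1 = {\<mu>. prob_space \<mu> \<and> sets \<mu> = sets borel \<and> integrable \<mu> (\<lambda>x. x)}"

text \<open>
  The integral of a convex function against a measure in \<^term>\<open>P1\<close> is well defined in
  \<open>(-\<infinity>, \<infinity>]\<close>, because its negative part is dominated by an affine function, but it may be
  \<open>\<infinity>\<close>, where the Bochner integral would return 0. Hence the extended-valued version,
  positive part minus negative part (\<^const>\<open>ennreal\<close> maps negative reals to 0).
\<close>

definition ext_integral :: "'a measure \<Rightarrow> ('a \<Rightarrow> real) \<Rightarrow> ereal" where
  "ext_integral M f =
     enn2ereal (\<integral>\<^sup>+ x. ennreal (f x) \<partial>M) - enn2ereal (\<integral>\<^sup>+ x. ennreal (- f x) \<partial>M)"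

lemma ext_integral_eq_integral:
  assumes "integrable M f"
  shows "ext_integral M f = ereal (integral\<^sup>L M f)"
proof -
  have "enn2ereal (\<integral>\<^sup>+ x. ennreal (g x) \<partial>M) = ereal (enn2real (\<integral>\<^sup>+ x. ennreal (g x) \<partial>M))"
    if "integrable M g" for g :: "'a \<Rightarrow> real"
  proof -
    have "(\<integral>\<^sup>+ x. ennreal (g x) \<partial>M) < \<infinity>"
      using real_integrable_def that by (auto simp: top.not_eq_extremum)
    then show ?thesis
      by (metis enn2ereal_ennreal enn2real_nonneg ennreal_enn2real infinity_ennreal_def)
  qed
  from this[OF assms] this[of "\<lambda>x. - f x"] assms show ?thesis
    by (simp add: ext_integral_def real_lebesgue_integral_def)
qed

definition convex_order :: "real measure \<Rightarrow> real measure \<Rightarrow> bool"  (infix "\<le>\<^sub>c\<^sub>x" 50) where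
  "\<mu> \<le>\<^sub>c\<^sub>x \<nu> \<longleftrightarrow> (\<forall>\<phi>. convex_on UNIV \<phi> \<longrightarrow> ext_integral \<mu> \<phi> \<le> ext_integral \<nu> \<phi>)"

text \<open>
  The random vector \<open>(X, Y)\<close> is realised canonically by the coordinate projections on
  \<open>\<real>\<^sup>2\<close>, so that conditioning on \<open>X\<close> is conditioning on the sigma-algebra generated
  by \<^const>\<open>fst\<close>.
\<close>

definition martingale_transports :: "real measure \<Rightarrow> real measure \<Rightarrow> (real \<times> real) measure set" where
  "martingale_transports \<mu> \<nu> =
     {\<pi>. prob_space \<pi> \<and> sets \<pi> = sets borel \<and>
         distr \<pi> borel fst = \<mu> \<and> distr \<pi> borel snd = \<nu> \<and>
         (AE z in \<pi>. real_cond_exp \<pi> (vimage_algebra UNIV fst borel) snd z = fst z)}"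

definition monge_martingale_transports ::
    "real measure \<Rightarrow> real measure \<Rightarrow> (real \<times> real) measure set" where
  "monge_martingale_transports \<mu> \<nu> =
     {\<pi> \<in> martingale_transports \<mu> \<nu>.
        \<exists>f \<in> borel_measurable borel. \<pi> = distr \<nu> borel (\<lambda>y. (f y, y))}"

definition T_rg :: "(real \<Rightarrow> real) \<Rightarrow> (real \<times> real) set" where
  "T_rg h = {(h y, y) | y. y \<in> UNIV}"

definition T_atom :: "real measure \<Rightarrow> (real \<times> real) set" where
  "T_atom \<nu> = {(x, y). measure \<nu> {y} > 0}"

definition atomless :: "real measure \<Rightarrow> bool" where
  "atomless \<nu> \<longleftrightarrow> (\<forall>y. measure \<nu> {y} = 0)"

end

theory Submission imports Defs
begin

text \<open>
  Realise \<open>\<nu>\<close> as the law of its quantile function \<open>q\<close> on the unit interval. A map \<open>f\<close> on the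
  unit interval with \<open>f \<sim> \<mu>\<close> and \<open>E[q | f] = f\<close> gives the transport as the law of \<open>(f, q)\<close>;
  it is a graph over \<open>y\<close> off the atoms of \<open>\<nu>\<close>, where \<open>q\<close> is inverted by the distribution function.
  To find \<open>f\<close>, cut \<open>\<mu>\<close> successively at all rationals \<open>c\<close>: whenever \<open>\<mu>\<close> restricted to \<open>X\<close> is
  below the law of \<open>q\<close> on a set \<open>E\<close> in convex order, \<open>E\<close> splits into two sets that dominate
  \<open>\<mu>\<close> on \<open>X \<inter> (-\<infinity>, c]\<close> and on \<open>X \<inter> (c, \<infinity>)\<close>. In the limit the cell containing \<open>u\<close>
  determines \<open>f u\<close>, and equality of masses and means on all cells gives the law of \<open>f\<close> and the
  martingale property.
\<close>

section \<open>Comparison of puts\<close>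

text \<open>This is the convex order between \<open>\<mu>\<close> restricted to \<open>X\<close> and
  the law of \<open>q\<close> on \<open>E\<close>, tested on put payoffs together with mass and
  mean. Keeping \<open>N\<close>, \<open>E\<close> and \<open>q\<close> separate lets
  \<open>E\<close> be subdivided while \<open>N\<close> and \<open>q\<close> stay fixed.\<close>

definition cx_below ::
    "real measure \<Rightarrow> real set \<Rightarrow> 'a measure \<Rightarrow> 'a set \<Rightarrow> ('a \<Rightarrow> real) \<Rightarrow> bool" where
  "cx_below \<mu> X N E q \<longleftrightarrow>
     measure \<mu> X = measure N E \<and>
     (LINT x:X|\<mu>. x) = (LINT u:E|N. q u) \<and>
     (\<forall>t. (LINT x:X|\<mu>. max 0 (t - x)) \<le> (LINT u:E|N. max 0 (t - q u)))"

lemma (in finite_measure) set_integrable_of_integrable: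
  fixes f :: "'a \<Rightarrow> real"
  assumes "integrable M f" "A \<in> sets M"
  shows "set_integrable M A f"
  unfolding set_integrable_def using assms by (rule integrable_mult_indicator[rotated])

lemma (in finite_measure) integrable_put:
  fixes q :: "'a \<Rightarrow> real"
  assumes "integrable M q"
  shows "integrable M (\<lambda>u. max 0 (t - q u))"
  using assms by (intro integrable_max Bochner_Integration.integrable_diff) auto

text \<open>Up to strike \<open>y\<close> only \<open>B\<close> contributes to the put, so
  restricting to \<open>A\<close> loses nothing. Between \<open>y\<close> and \<open>c\<close> the
  convex \<open>f\<close> lies below its chord, and the chord lies below the line \<open>T\<close>
  given by the integral over \<open>B\<close>, which the put on \<open>A\<close> dominates.\<close>

lemma (in finite_measure) put_bound:
  fixes q :: "'a \<Rightarrow> real"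
  assumes q: "integrable M q"
    and A: "A \<in> sets M" and B: "B \<in> sets M" "B \<subseteq> A"
    and qB: "AE u in M. u \<in> B \<longrightarrow> q u \<le> y"
    and qnB: "AE u in M. u \<notin> B \<longrightarrow> y \<le> q u"
    and qA: "AE u in M. u \<in> A \<longrightarrow> u \<notin> B \<longrightarrow> c \<le> q u"
    and y: "y \<le> c"
    and f: "convex_on UNIV f"
    and below: "\<And>s. f s \<le> (\<integral>u. max 0 (s - q u) \<partial>M)"
    and fc: "f c \<le> (LINT u:A|M. c - q u)"
    and t: "t \<le> c"
  shows "f t \<le> (LINT u:A|M. max 0 (t - q u))"
proof -
  note [measurable] = A B borel_measurable_integrable[OF q]
  have iq: "integrable M (\<lambda>u. s - q u)" for s using q by auto
  note si = set_integrable_of_integrable[OF iq] set_integrable_of_integrable[OF integrable_put[OF q]]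
  have low: "f s \<le> (LINT u:A|M. max 0 (s - q u))" if "s \<le> y" for s
  proof -
    have "(\<integral>u. max 0 (s - q u) \<partial>M) = (LINT u:A|M. max 0 (s - q u))"
      unfolding set_lebesgue_integral_def
      by (rule integral_cong_AE) (use qnB B that in \<open>auto simp: indicator_def\<close>)
    with below[of s] show ?thesis by simp
  qed
  define T where "T s = (LINT u:B|M. s - q u)" for s
  have T: "T s = s * measure M B - (LINT u:B|M. q u)" for s
    unfolding T_def
    by (subst set_integral_diff(2))
      (auto simp: set_integrable_of_integrable q set_integral_const)
  have Ty: "f y \<le> T y"
  proof -
    have "(LINT u:A|M. max 0 (y - q u)) = T y"
      unfolding T_def set_lebesgue_integral_def
      by (rule integral_cong_AE) (use qnB qB B in \<open>auto simp: indicator_def\<close>)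
    with low[of y] show ?thesis by simp
  qed
  \<comment> \<open>Dropping \<open>A - B\<close> from the integral can only increase it, since
    \<open>c - q u\<close> is nonpositive there.\<close>
  have Tc: "f c \<le> T c"
  proof -
    have "(LINT u:A|M. c - q u) \<le> T c"
      unfolding T_def set_lebesgue_integral_def
      by (intro integral_mono_AE si[unfolded set_integrable_def] A B(1))
        (use qA B in \<open>auto simp: indicator_def elim!: eventually_mono\<close>)
    with fc show ?thesis by simp
  qed
  show ?thesis
  proof (cases "t \<le> y")
    case True
    then show ?thesis by (rule low)
  next
    case False
    define l where "l = (t - y) / (c - y)"
    have "l * (c - y) = t - y" using False t by (simp add: l_def)
    then have "t = (1 - l) * y + l * c" by (simp add: algebra_simps)
    moreover have "0 \<le> l" "l \<le> 1" using False t y by (auto simp: l_def divide_simps)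
    ultimately have l: "0 \<le> l" "l \<le> 1" "t = (1 - l) * y + l * c" by auto
    have "f t \<le> (1 - l) * f y + l * f c"
      using convex_onD[OF f, of l y c] l by simp
    also have "\<dots> \<le> (1 - l) * T y + l * T c"
      using Ty Tc l by (intro add_mono mult_left_mono) auto
    also have "\<dots> = T t" unfolding T l(3) by (simp add: algebra_simps)
    also have "T t \<le> (LINT u:A|M. max 0 (t - q u))"
      unfolding T_def set_lebesgue_integral_def
      by (intro integral_mono si[unfolded set_integrable_def] A B(1))
        (use B in \<open>auto simp: indicator_def\<close>)
    finally show ?thesis .
  qed
qed

section \<open>Splitting at a threshold\<close>

text \<open>The intended \<open>M\<close> is Lebesgue measure on the unit interval or its
  restriction to a cell, so the total mass is left arbitrary. Absence of atoms makes it possible to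
  cut off a lower piece of any prescribed mass.\<close>

locale mono_quantile = finite_borel_measure M for M +
  fixes q :: "real \<Rightarrow> real"
  assumes atomless: "measure M {u} = 0"
    and AE_unit: "AE u in M. u \<in> {0<..<1}"
    and q: "integrable M q"
    and mono_q: "mono_on {0<..<1} q"
begin

section \<open>Levels of the distribution function and the integrated quantile function\<close>

abbreviation "G \<equiv> cdf M"
abbreviation "w \<equiv> measure M UNIV"

lemma q_meas [measurable]: "q \<in> borel_measurable borel"
  using borel_measurable_integrable[OF q] M_is_borel by (simp cong: measurable_cong_sets)

lemma G_meas [measurable]: "G \<in> borel_measurable borel"
  by (intro borel_measurable_mono monoI cdf_nondecreasing)

lemma sets_M [simp, measurable_cong]: "sets M = sets borel" by (rule M_is_borel)

lemma space_M [simp]: "space M = UNIV" by (rule borel_UNIV)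

lemma G_cont: "continuous_on S G"
  using atomless by (simp add: continuous_at_imp_continuous_on isCont_cdf)

lemma G_0: "G 0 = 0"
proof -
  have "measure M {..0} = measure M {}"
    by (rule measure_eq_AE) (use AE_unit in auto)
  then show ?thesis by (simp add: cdf_def)
qed

lemma G_1: "G 1 = w"
  unfolding cdf_def by (rule measure_eq_AE) (use AE_unit in auto)

lemma level_point:
  assumes "0 \<le> v" "v \<le> w"
  obtains a where "a \<in> {0..1}" "G a = v"
  using IVT'[of G 0 v 1] assms G_0 G_1 G_cont by auto

text \<open>Inside the unit interval the level set is compact. \<open>G\<close> agrees at its least
  and greatest points, so the interval between them has no mass, and the least point itself is not
  an atom.\<close>

lemma AE_level: "AE u in M. G u \<noteq> v"
proof -
  define T where "T = {u \<in> {0..1}. G u = v}"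
  have "compact T"
  proof -
    have "closed T" unfolding T_def
      by (intro continuous_closed_preimage_constant G_cont) auto
    moreover have "T \<subseteq> {0..1}" by (auto simp: T_def)
    ultimately show ?thesis by (metis compact_Icc compact_Int_closed inf.absorb_iff2)
  qed
  have "AE u in M. u \<notin> T"
  proof (cases "T = {}")
    case False
    obtain a where a: "a \<in> T" "\<And>x. x \<in> T \<Longrightarrow> a \<le> x"
      using compact_attains_inf[OF \<open>compact T\<close> False] by auto
    obtain b where b: "b \<in> T" "\<And>x. x \<in> T \<Longrightarrow> x \<le> b"
      using compact_attains_sup[OF \<open>compact T\<close> False] by auto
    have "a \<le> b" using a b by auto
    have "measure M {a<..b} = 0"
      using cdf_diff_eq[of a b] a b \<open>a \<le> b\<close> by (cases "a = b") (auto simp: T_def)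
    then have "AE u in M. u \<notin> {a<..b}"
      by (intro AE_not_in) (simp add: null_sets_def emeasure_eq_measure)
    moreover have "AE u in M. u \<noteq> a"
      using AE_not_in[of "{a}" M] by (simp add: null_sets_def emeasure_eq_measure atomless)
    ultimately show ?thesis by eventually_elim (use a b in force)
  qed simp
  then show ?thesis using AE_unit by eventually_elim (auto simp: T_def)
qed

text \<open>This is the probability integral transform: \<open>G\<close> is uniform on the range
  from 0 to \<open>w\<close>, because up to a null set its sublevel set is a half-line ending at a
  point of level \<open>v\<close>.\<close>

lemma measure_level:
  assumes "0 \<le> v" "v \<le> w"
  shows "measure M {u. G u \<le> v} = v"
proof -
  obtain a where a: "G a = v" using level_point assms by blast
  have "measure M {u. G u \<le> v} = measure M {..a}"
  proof (rule measure_eq_AE)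
    show "AE u in M. u \<in> {u. G u \<le> v} \<longleftrightarrow> u \<in> {..a}"
      using AE_level[of v]
    proof eventually_elim
      case (elim u)
      show ?case using cdf_nondecreasing[of u a] cdf_nondecreasing[of a u] a elim by force
    qed
  qed auto
  with a show ?thesis by (simp add: cdf_def)
qed

text \<open>This is the integrated quantile function (unnormalised Lorenz curve), with the mass
  \<open>v\<close> as its argument.\<close>

definition J :: "real \<Rightarrow> real" where
  "J v = (LINT u:{u. G u \<le> v}|M. q u)"

text \<open>Dominated convergence applies, since the indicators of the sublevel sets are eventually
  constant off the null set where \<open>G u = v\<close>.\<close>

lemma J_cont: "continuous_on S J"
proof (rule continuous_at_imp_continuous_on, rule ballI)
  fix v :: real
  show "isCont J v"
    unfolding continuous_at_sequentially comp_def
  proof safe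
    fix x :: "nat \<Rightarrow> real" assume x: "x \<longlonglongrightarrow> v"
    show "(\<lambda>n. J (x n)) \<longlonglongrightarrow> J v"
      unfolding J_def set_lebesgue_integral_def
    proof (rule integral_dominated_convergence[where w = "\<lambda>u. \<bar>q u\<bar>"])
      show "AE u in M. (\<lambda>n. indicator {u. G u \<le> x n} u *\<^sub>R q u)
              \<longlonglongrightarrow> indicator {u. G u \<le> v} u *\<^sub>R q u"
        using AE_level[of v]
      proof eventually_elim
        case (elim u)
        have "\<forall>\<^sub>F n in sequentially.
            indicator {u. G u \<le> x n} u *\<^sub>R q u = indicator {u. G u \<le> v} u *\<^sub>R q u"
        proof (cases "G u < v")
          case True
          show ?thesis using order_tendstoD(1)[OF x True] by eventually_elim (use True in auto)
        next
          case False
          with elim have "v < G u" by simp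
          from order_tendstoD(2)[OF x this] show ?thesis
            by eventually_elim (use \<open>v < G u\<close> in auto)
        qed
        then show ?case by (rule tendsto_eventually)
      qed
    qed (use q in \<open>auto simp: indicator_def\<close>)
  qed
qed

end

section \<open>Set integrals under a finite measure: affine integrands, bounds, put-call
  parity\<close>

lemma (in finite_measure) set_integral_affine:
  fixes f :: "'a \<Rightarrow> real"
  assumes "integrable M f" "S \<in> sets M"
  shows "(LINT u:S|M. t - f u) = t * measure M S - (LINT u:S|M. f u)"
  using assms
  by (subst set_integral_diff(2)) (auto simp: set_integrable_of_integrable set_integral_const)

lemma (in finite_measure) set_integral_split:
  fixes f :: "'a \<Rightarrow> real"
  assumes "integrable M f" "S \<in> sets M" "T \<in> sets M" "S \<subseteq> T"
  shows "(LINT u:T|M. f u) = (LINT u:S|M. f u) + (LINT u:T-S|M. f u)"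
proof -
  have "T = S \<union> (T - S)" using assms by auto
  moreover have "(LINT u:S \<union> (T - S)|M. f u) = (LINT u:S|M. f u) + (LINT u:T-S|M. f u)"
    using assms by (intro set_integral_Un set_integrable_of_integrable) auto
  ultimately show ?thesis by simp
qed

lemma (in finite_measure) set_integral_null:
  fixes f :: "'a \<Rightarrow> real"
  assumes "measure M S = 0" "S \<in> sets M"
  shows "(LINT u:S|M. f u) = 0"
proof -
  have "AE u in M. u \<notin> S"
    using assms by (intro AE_not_in) (simp add: null_sets_def emeasure_eq_measure)
  then show ?thesis
    unfolding set_lebesgue_integral_def
    by (intro integral_eq_zero_AE) (auto simp: indicator_def)
qed

lemma (in finite_measure) set_integral_le_const:
  fixes f :: "'a \<Rightarrow> real"
  assumes "integrable M f" "S \<in> sets M" "AE u in M. u \<in> S \<longrightarrow> f u \<le> c"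
  shows "(LINT u:S|M. f u) \<le> c * measure M S"
proof -
  have "(LINT u:S|M. f u) \<le> (LINT u:S|M. c)"
    using assms by (intro set_integral_mono_AE set_integrable_of_integrable) auto
  then show ?thesis using assms by (simp add: set_integral_const mult.commute)
qed

lemma (in finite_measure) set_integral_ge_const:
  fixes f :: "'a \<Rightarrow> real"
  assumes "integrable M f" "S \<in> sets M" "AE u in M. u \<in> S \<longrightarrow> c \<le> f u"
  shows "c * measure M S \<le> (LINT u:S|M. f u)"
proof -
  have "(LINT u:S|M. c) \<le> (LINT u:S|M. f u)"
    using assms by (intro set_integral_mono_AE set_integrable_of_integrable) auto
  then show ?thesis using assms by (simp add: set_integral_const mult.commute)
qed

text \<open>Put-call parity: a real number is its positive part minus its negative part. With equal
  masses and means it makes comparing calls the same as comparing puts.\<close>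

lemma (in finite_measure) set_integral_put_call:
  fixes f :: "'a \<Rightarrow> real"
  assumes "integrable M f" "S \<in> sets M"
  shows "(LINT u:S|M. max 0 (t - f u)) =
    (LINT u:S|M. max 0 (f u - t)) + t * measure M S - (LINT u:S|M. f u)"
proof -
  have "(LINT u:S|M. max 0 (t - f u)) = (LINT u:S|M. max 0 (f u - t) + (t - f u))"
    by (intro arg_cong[where f = "set_lebesgue_integral M S"]) (auto simp: fun_eq_iff max_def)
  also have "\<dots> = (LINT u:S|M. max 0 (f u - t)) + (LINT u:S|M. t - f u)"
    using assms integrable_put[of "\<lambda>u. - f u" "-t"]
    by (intro set_integral_add set_integrable_of_integrable) auto
  finally show ?thesis using assms by (simp add: set_integral_affine)
qed

lemma (in finite_measure) convex_on_put:
  fixes f :: "'a \<Rightarrow> real"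
  assumes "integrable M f"
  shows "convex_on UNIV (\<lambda>s. \<integral>u. max 0 (s - f u) \<partial>M)"
proof (rule convex_onI)
  fix t x y :: real assume t: "0 < t" "t < 1"
  note i = integrable_put[OF assms]
  have "(\<integral>u. max 0 ((1 - t) *\<^sub>R x + t *\<^sub>R y - f u) \<partial>M)
      \<le> (\<integral>u. (1 - t) * max 0 (x - f u) + t * max 0 (y - f u) \<partial>M)"
  proof (rule integral_mono)
    fix u
    have "(1 - t) *\<^sub>R x + t *\<^sub>R y - f u = (1 - t) * (x - f u) + t * (y - f u)"
      by (simp add: algebra_simps)
    also have "\<dots> \<le> (1 - t) * max 0 (x - f u) + t * max 0 (y - f u)"
      using t by (intro add_mono mult_left_mono) auto
    finally show "max 0 ((1 - t) *\<^sub>R x + t *\<^sub>R y - f u)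
        \<le> (1 - t) * max 0 (x - f u) + t * max 0 (y - f u)"
      using t by simp
  qed (use i in auto)
  also have "\<dots> = (1 - t) * (\<integral>u. max 0 (x - f u) \<partial>M) + t * (\<integral>u. max 0 (y - f u) \<partial>M)"
    using i by simp
  finally show "(\<integral>u. max 0 ((1 - t) *\<^sub>R x + t *\<^sub>R y - f u) \<partial>M)
    \<le> (1 - t) * (\<integral>u. max 0 (x - f u) \<partial>M) + t * (\<integral>u. max 0 (y - f u) \<partial>M)" .
qed simp

section \<open>Splitting the whole space at one threshold\<close>

context mono_quantile
begin

text \<open>A point \<open>a\<close> of level \<open>v\<close> separates smaller from larger values
  of \<open>q\<close> by monotonicity. The strict bounds on \<open>v\<close> keep \<open>a\<close>
  off the endpoints, where \<open>q\<close> need not be monotone.\<close>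

lemma AE_threshold:
  assumes "0 < v" "v < w"
  obtains a where "a \<in> {0<..<1}" "G a = v"
    "AE u in M. G u \<le> v \<longrightarrow> q u \<le> q a" "AE u in M. v \<le> G u \<longrightarrow> q a \<le> q u"
proof -
  obtain a where a: "a \<in> {0..1}" "G a = v" using level_point[of v] assms by auto
  have a1: "a \<in> {0<..<1}"
    using a assms G_0 G_1 by (cases "a = 0"; cases "a = 1") auto
  have 1: "AE u in M. G u \<le> v \<longrightarrow> q u \<le> q a"
    using AE_unit AE_level[of v]
  proof eventually_elim
    case (elim u)
    show ?case
      using cdf_nondecreasing[of a u] elim a a1 mono_onD[OF mono_q, of u a] by force
  qed
  have 2: "AE u in M. v \<le> G u \<longrightarrow> q a \<le> q u"
    using AE_unit AE_level[of v]
  proof eventually_elim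
    case (elim u)
    show ?case
      using cdf_nondecreasing[of u a] elim a a1 mono_onD[OF mono_q, of a u] by force
  qed
  from 1 2 a a1 that show ?thesis by blast
qed

text \<open>
  The barcode: of the mass of \<open>q\<close> to the left of \<open>c\<close> the set \<open>A\<close> omits the piece
  adjacent to \<open>c\<close>, and from the right of \<open>c\<close> it takes the piece adjacent to \<open>c\<close>.
  Then the puts of \<open>A\<close> agree with those of the whole space up to the omitted piece and are
  affine from there to \<open>c\<close>, so convexity reduces the comparison to the strike \<open>c\<close>.
\<close>

theorem cx_below_split:
  assumes m: "finite_borel_measure m" and im: "integrable m (\<lambda>x. x)"
    and below: "cx_below m UNIV M UNIV q"
  shows "\<exists>A\<in>sets borel. cx_below m {..c} M A q \<and> cx_below m {c<..} M (- A) q"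
proof -
  interpret m: finite_borel_measure m by (rule m)
  have sets_m [simp, measurable_cong]: "sets m = sets borel" by (rule m.M_is_borel)
  have space_m [simp]: "space m = UNIV" by (rule m.borel_UNIV)
  have mass: "measure m UNIV = w" and mean: "(\<integral>x. x \<partial>m) = (\<integral>u. q u \<partial>M)"
    and put: "\<And>t. (\<integral>x. max 0 (t - x) \<partial>m) \<le> (\<integral>u. max 0 (t - q u) \<partial>M)"
    using below by (auto simp: cx_below_def set_lebesgue_integral_def)
  define p where "p = measure m {..c}"
  define p' where "p' = measure m {c<..}"
  define M1 where "M1 = (LINT x:{..c}|m. x)"
  define M2 where "M2 = (LINT x:{c<..}|m. x)"
  have Compl: "UNIV - {..c} = {c<..}" by auto
  have pp': "p + p' = w"
    using m.finite_measure_compl[of "{..c}"] mass by (simp add: p_def p'_def Compl)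
  have M12: "M1 + M2 = (\<integral>u. q u \<partial>M)"
    using m.set_integral_split[OF im, of "{..c}" UNIV] mean
    by (simp add: M1_def M2_def Compl set_lebesgue_integral_def)
  have p0: "0 \<le> p" "0 \<le> p'" "p \<le> w"
    using pp' measure_nonneg[of m "{..c}"] measure_nonneg[of m "{c<..}"]
    unfolding p_def p'_def by linarith+
  have M1_le: "M1 \<le> c * p"
    unfolding M1_def p_def by (intro m.set_integral_le_const im) auto
  have M2_ge: "c * p' \<le> M2"
    unfolding M2_def p'_def by (intro m.set_integral_ge_const im) auto

  \<comment> \<open>\<open>g\<close> is the position of \<open>c\<close> on the scale of levels:
    almost everywhere \<open>q\<close> is at most \<open>c\<close> at levels up to \<open>g\<close>
    and at least \<open>c\<close> above.\<close>
  define g where "g = measure M {u \<in> {0<..<1}. q u \<le> c}"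
  have g: "0 \<le> g" "g \<le> w"
    unfolding g_def by (auto intro!: finite_measure_mono)
  have lt_g: "q u \<le> c" if "u \<in> {0<..<1}" "G u < g" for u
  proof (rule ccontr)
    assume "\<not> q u \<le> c"
    then have "{u \<in> {0<..<1}. q u \<le> c} \<subseteq> {..u}"
      using mono_onD[OF mono_q, of u] that by (force simp: not_le)
    then have "g \<le> G u" unfolding g_def cdf_def by (intro finite_measure_mono) auto
    with that show False by simp
  qed
  have gt_g: "c \<le> q u" if "u \<in> {0<..<1}" "g < G u" for u
  proof (rule ccontr)
    assume n: "\<not> c \<le> q u"
    have "G u \<le> g"
      unfolding g_def cdf_def
    proof (rule finite_measure_mono_AE)
      show "AE v in M. v \<in> {..u} \<longrightarrow> v \<in> {u \<in> {0<..<1}. q u \<le> c}"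
        using AE_unit
      proof eventually_elim
        case (elim v)
        show ?case using mono_onD[OF mono_q, of v u] that elim n by force
      qed
    qed auto
    with that show False by simp
  qed
  have AE_le_c: "AE u in M. G u \<le> g \<longrightarrow> q u \<le> c"
    using AE_unit AE_level[of g] by eventually_elim (use lt_g in force)
  have AE_ge_c: "AE u in M. g < G u \<longrightarrow> c \<le> q u"
    using AE_unit by eventually_elim (use gt_g in force)

  define lev where "lev v = {u. G u \<le> v}" for v
  have lev [measurable]: "lev v \<in> sets borel" for v unfolding lev_def by measurable
  have J_lev: "J v = (LINT u:lev v|M. q u)" for v by (simp add: J_def lev_def)
  have meas_lev: "measure M (lev v) = v" if "0 \<le> v" "v \<le> w" for v
    using measure_level that by (simp add: lev_def)
  have lev_mono: "lev v \<subseteq> lev v'" if "v \<le> v'" for v v' using that by (auto simp: lev_def)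
  have meas_diff: "measure M (lev v' - lev v) = v' - v" if "0 \<le> v" "v \<le> v'" "v' \<le> w" for v v'
    using that lev_mono[of v v'] by (simp add: finite_measure_Diff meas_lev)
  have J_diff: "(LINT u:lev v' - lev v|M. q u) = J v' - J v" if "v \<le> v'" for v v'
    using set_integral_split[OF q _ _ lev_mono[OF that]] by (simp add: J_lev)
  have J_w: "J w = (\<integral>u. q u \<partial>M)"
  proof -
    have "G u \<le> w" for u unfolding cdf_def by (intro finite_measure_mono) auto
    then have "lev w = UNIV" by (auto simp: lev_def)
    then show ?thesis by (simp add: J_lev set_lebesgue_integral_def)
  qed
  have J_0: "J 0 = 0"
    unfolding J_lev by (intro set_integral_null) (auto simp: meas_lev)

  \<comment> \<open>\<open>J p\<close> is the least integral of \<open>q\<close> over mass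
    \<open>p\<close>. The comparison comes from the put at strike \<open>q a\<close>, which for
    \<open>q\<close> is attained on \<open>lev p\<close>. The extreme values of \<open>p\<close>
    have no such threshold and are settled by total mass and mean.\<close>
  have J_p: "J p \<le> M1"
  proof -
    consider "p = 0" | "p = w" | "0 < p" "p < w" using p0 by linarith
    then show ?thesis
    proof cases
      case 1
      then have "M1 = 0" unfolding M1_def by (intro m.set_integral_null) (auto simp: p_def)
      with 1 J_0 show ?thesis by simp
    next
      case 2
      then have "M2 = 0"
        unfolding M2_def using pp' by (intro m.set_integral_null) (auto simp: p'_def)
      with 2 J_w M12 show ?thesis by simp
    next
      case 3
      obtain a where a: "a \<in> {0<..<1}" "G a = p" "AE u in M. G u \<le> p \<longrightarrow> q u \<le> q a"
        "AE u in M. p \<le> G u \<longrightarrow> q a \<le> q u"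
        by (rule AE_threshold[of p]) (use 3 in linarith)+
      have "q a * p - M1 = (LINT x:{..c}|m. q a - x)"
        using m.set_integral_affine[OF im, of "{..c}" "q a"] by (simp add: M1_def p_def)
      also have "\<dots> \<le> (\<integral>x. max 0 (q a - x) \<partial>m)"
        unfolding set_lebesgue_integral_def
        using im m.integrable_put[OF im]
        by (intro integral_mono m.set_integrable_of_integrable[unfolded set_integrable_def])
          (auto simp: indicator_def)
      also have "\<dots> \<le> (\<integral>u. max 0 (q a - q u) \<partial>M)" by (rule put)
      also have "\<dots> = (LINT u:lev p|M. q a - q u)"
        unfolding set_lebesgue_integral_def
      proof (rule integral_cong_AE)
        show "AE u in M. max 0 (q a - q u) = indicat_real (lev p) u *\<^sub>R (q a - q u)"
          using a(3,4) by eventually_elim (auto simp: lev_def indicator_def)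
      qed auto
      also have "\<dots> = q a * p - J p"
        using p0 by (subst set_integral_affine[OF q]) (auto simp: meas_lev J_lev)
      finally show ?thesis by simp
    qed
  qed

  \<comment> \<open>\<open>\<Psi> x\<close> is the integral of \<open>q\<close> over the levels up
    to \<open>x\<close> together with those between \<open>g\<close> and \<open>g + p - x\<close>, a
    set of mass \<open>p\<close> for every admissible \<open>x\<close>. The bounds \<open>lo\<close>
    and \<open>hi\<close> keep both pieces within range.\<close>
  define \<Psi> where "\<Psi> x = J x + J (g + p - x) - J g" for x
  define lo where "lo = max 0 (g + p - w)"
  define hi where "hi = min p g"
  have "lo \<le> hi" using g p0 by (auto simp: lo_def hi_def)
  \<comment> \<open>At \<open>hi\<close> the two pieces join into \<open>lev p\<close>, so the value
    is \<open>J p\<close>.\<close>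
  have "\<Psi> hi \<le> M1" using J_p by (auto simp: \<Psi>_def hi_def min_def)
  \<comment> \<open>At \<open>lo\<close> either all chosen mass lies above \<open>c\<close>, or
    everything above \<open>c\<close> is chosen and the omitted mass lies below \<open>c\<close>. In
    the latter case the omitted mass is compared with \<open>M2\<close>.\<close>
  have "M1 \<le> \<Psi> lo"
  proof (cases "g + p \<le> w")
    case True
    then have "\<Psi> lo = (LINT u:lev (g + p) - lev g|M. q u)"
      using p0 by (simp add: \<Psi>_def lo_def J_0 J_diff)
    also have "\<dots> \<ge> c * measure M (lev (g + p) - lev g)"
    proof (intro set_integral_ge_const q)
      show "AE u in M. u \<in> lev (g + p) - lev g \<longrightarrow> c \<le> q u"
        using AE_ge_c by eventually_elim (auto simp: lev_def)
    qed auto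
    also have "measure M (lev (g + p) - lev g) = p" using True g p0 by (subst meas_diff) auto
    finally show ?thesis using M1_le by simp
  next
    case False
    then have lo: "lo = g + p - w" by (simp add: lo_def)
    have "J g - J lo = (LINT u:lev g - lev lo|M. q u)"
      using p0 by (subst J_diff) (auto simp: lo)
    also have "\<dots> \<le> c * measure M (lev g - lev lo)"
    proof (intro set_integral_le_const q)
      show "AE u in M. u \<in> lev g - lev lo \<longrightarrow> q u \<le> c"
        using AE_le_c by eventually_elim (auto simp: lev_def)
    qed auto
    also have "measure M (lev g - lev lo) = p'"
      using False g p0 pp' by (subst meas_diff) (auto simp: lo)
    finally have "J g - J lo \<le> M2" using M2_ge by simp
    then show ?thesis using M12 by (simp add: \<Psi>_def lo J_w)
  qed
  have "continuous_on {lo..hi} \<Psi>"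
    unfolding \<Psi>_def
    by (intro continuous_intros continuous_on_compose2[OF J_cont[of UNIV]] J_cont) auto
  with \<open>\<Psi> hi \<le> M1\<close> \<open>M1 \<le> \<Psi> lo\<close> \<open>lo \<le> hi\<close> obtain x where x: "lo \<le> x" "x \<le> hi" "\<Psi> x = M1"
    using IVT2'[of \<Psi> hi M1 lo] by auto
  define z where "z = g + p - x"
  have xz: "0 \<le> x" "x \<le> g" "x \<le> p" "g \<le> z" "z \<le> w"
    using x by (auto simp: lo_def hi_def z_def)
  define A where "A = lev x \<union> (lev z - lev g)"
  have A [measurable]: "A \<in> sets borel" by (simp add: A_def)
  have disj: "lev x \<inter> (lev z - lev g) = {}" using lev_mono[of x g] xz by auto
  have meas_A: "measure M A = p"
    unfolding A_def using xz g disj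
    by (subst finite_measure_Union) (auto simp: meas_lev meas_diff z_def)
  have int_A: "(LINT u:A|M. q u) = M1"
  proof -
    have "(LINT u:A|M. q u) = J x + (J z - J g)"
      unfolding A_def using xz disj
      by (subst set_integral_Un)
        (auto intro!: set_integrable_of_integrable[OF q] simp: J_lev[symmetric] J_diff)
    then show ?thesis using x by (simp add: \<Psi>_def z_def)
  qed
  have meas_nA: "measure M (- A) = p'"
    using finite_measure_compl[of A] pp' meas_A by (simp add: Compl_eq_Diff_UNIV)
  have int_nA: "(LINT u:- A|M. q u) = M2"
    using set_integral_split[OF q, of A UNIV] int_A M12
    by (simp add: Compl_eq_Diff_UNIV set_lebesgue_integral_def)

  have puts: "(LINT x:{..c}|m. max 0 (t - x)) \<le> (LINT u:A|M. max 0 (t - q u))" for t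
  proof (cases "t \<le> c")
    case True
    \<comment> \<open>For strikes up to \<open>c\<close> the part of \<open>m\<close> beyond
      \<open>c\<close> contributes nothing, so the restricted put equals the full one, which is
      convex and bounded by hypothesis. At strike \<open>c\<close> it is affine in the position, so
      mass and mean determine it.\<close>
    define f where "f s = (\<integral>x. max 0 (s - x) \<partial>m)" for s
    have "(LINT x:{..c}|m. max 0 (t - x)) = f t"
      unfolding f_def set_lebesgue_integral_def
      using True by (intro Bochner_Integration.integral_cong) (auto simp: indicator_def)
    moreover have "f t \<le> (LINT u:A|M. max 0 (t - q u))"
    proof -
      have "f c = (LINT x:{..c}|m. c - x)"
        unfolding f_def set_lebesgue_integral_def
        by (intro Bochner_Integration.integral_cong) (auto simp: indicator_def)
      then have fc: "f c = (LINT u:A|M. c - q u)"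
        using m.set_integral_affine[OF im, of "{..c}" c] set_integral_affine[OF q, of A c]
        by (simp add: meas_A int_A p_def M1_def)
      have A_ge: "AE u in M. u \<in> A \<longrightarrow> u \<notin> lev x \<longrightarrow> c \<le> q u"
        using AE_ge_c by eventually_elim (auto simp: A_def lev_def)
      have bound: ?thesis if "y \<le> c" "AE u in M. G u \<le> x \<longrightarrow> q u \<le> y"
        "AE u in M. x < G u \<longrightarrow> y \<le> q u" for y
      proof (rule put_bound[OF q _ _ _ _ _ A_ge])
        show "convex_on UNIV f" unfolding f_def by (rule m.convex_on_put[OF im])
      qed (use that put fc True in \<open>auto simp: A_def lev_def f_def not_le\<close>)
      \<comment> \<open>The value separating the lower piece from the omitted one is
        \<open>q a\<close> for interior \<open>x\<close>, and \<open>c\<close> if nothing is omitted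
        below \<open>c\<close>. If the lower piece is empty, \<open>A\<close> lies above
        \<open>c\<close> and the put of \<open>m\<close> at \<open>c\<close> is at most 0.\<close>
      consider "x = 0" | "x = g" | "0 < x" "x < g" using xz by linarith
      then show ?thesis
      proof cases
        case 1
        have "AE u in M. u \<in> A \<longrightarrow> c - q u \<le> 0"
          using A_ge AE_level[of 0]
        proof eventually_elim
          case (elim u)
          then have "u \<notin> lev x" using cdf_nonneg[of u] 1 by (simp add: lev_def)
          with elim show ?case by simp
        qed
        then have "f c \<le> 0 * measure M A"
          unfolding fc by (intro set_integral_le_const) (use q in auto)
        moreover have "f t \<le> f c"
          unfolding f_def using True by (intro integral_mono m.integrable_put[OF im]) auto
        moreover have "0 \<le> (LINT u:A|M. max 0 (t - q u))"
          unfolding set_lebesgue_integral_def by (intro Bochner_Integration.integral_nonneg) auto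
        ultimately show ?thesis by simp
      next
        case 2
        then show ?thesis by (intro bound[of c]) (use AE_le_c AE_ge_c in auto)
      next
        case 3
        obtain a where a: "a \<in> {0<..<1}" "G a = x" "AE u in M. G u \<le> x \<longrightarrow> q u \<le> q a"
          "AE u in M. x \<le> G u \<longrightarrow> q a \<le> q u"
          by (rule AE_threshold[of x]) (use 3 xz g in linarith)+
        show ?thesis
        proof (rule bound[of "q a"])
          show "q a \<le> c" using lt_g[of a] a 3 by simp
        qed (use a in auto)
      qed
    qed
    ultimately show ?thesis by simp
  next
    case False
    have "(LINT x:{..c}|m. max 0 (t - x)) = (LINT x:{..c}|m. t - x)"
      unfolding set_lebesgue_integral_def
      using False by (intro Bochner_Integration.integral_cong) (auto simp: indicator_def)
    also have "\<dots> = (LINT u:A|M. t - q u)"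
      using m.set_integral_affine[OF im, of "{..c}" t] set_integral_affine[OF q, of A t]
      by (simp add: meas_A int_A p_def M1_def)
    also have "\<dots> \<le> (LINT u:A|M. max 0 (t - q u))"
      using q by (intro set_integral_mono set_integrable_of_integrable integrable_put) auto
    finally show ?thesis .
  qed
  have call: "(\<integral>x. max 0 (x - t) \<partial>m) \<le> (\<integral>u. max 0 (q u - t) \<partial>M)" for t
    using m.set_integral_put_call[OF im, of UNIV t] set_integral_put_call[OF q, of UNIV t]
      put[of t] mean mass by (simp add: set_lebesgue_integral_def)
  have calls: "(LINT x:{c<..}|m. max 0 (x - t)) \<le> (LINT u:- A|M. max 0 (q u - t))" for t
  proof (cases "c \<le> t")
    case True
    \<comment> \<open>Reflection turns calls above \<open>c\<close> into puts of \<open>- q\<close>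
      with strikes up to \<open>- c\<close>. Then \<open>put_bound\<close> applies with
      \<open>- A\<close> for the set and \<open>- lev z\<close> for its extreme piece; what remains
      of \<open>- A\<close> lies below \<open>c\<close>.\<close>
    define f where "f s = (\<integral>x. max 0 (s - (- x)) \<partial>m)" for s
    have "(LINT x:{c<..}|m. max 0 (x - t)) = f (- t)"
      unfolding f_def set_lebesgue_integral_def
      using True by (intro Bochner_Integration.integral_cong) (auto simp: indicator_def)
    moreover have "f (- t) \<le> (LINT u:- A|M. max 0 (- t - (- q u)))"
    proof -
      have "f (- c) = (LINT x:{c<..}|m. - c - (- x))"
        unfolding f_def set_lebesgue_integral_def
        by (intro Bochner_Integration.integral_cong) (auto simp: indicator_def)
      then have fc: "f (- c) = (LINT u:- A|M. - c - (- q u))"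
        using m.set_integral_affine[of "\<lambda>x. - x" "{c<..}" "-c"] im q
          set_integral_affine[of "\<lambda>u. - q u" "- A" "-c"] meas_nA int_nA
        by (simp add: p'_def M2_def set_lebesgue_integral_def)
      have A_le: "AE u in M. u \<in> - A \<longrightarrow> u \<notin> - lev z \<longrightarrow> - c \<le> - q u"
        using AE_le_c by eventually_elim (auto simp: A_def lev_def)
      have bound: ?thesis if "c \<le> y" "AE u in M. G u \<le> z \<longrightarrow> q u \<le> y"
        "AE u in M. z < G u \<longrightarrow> y \<le> q u" for y
      proof (rule put_bound[OF _ _ _ _ _ _ A_le])
        show "convex_on UNIV f"
          unfolding f_def by (rule m.convex_on_put) (use im in auto)
        show "AE u in M. u \<in> - lev z \<longrightarrow> - q u \<le> - y"
          using that(3) by (auto simp: lev_def not_le)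
        show "f s \<le> (\<integral>u. max 0 (s - (- q u)) \<partial>M)" for s
          using call[of "- s"] by (simp add: f_def add.commute)
        show "- lev z \<subseteq> - A"
          using lev_mono[of x z] xz by (auto simp: A_def)
      qed (use that fc True q in \<open>auto simp: lev_def f_def\<close>)
      consider "z = w" | "z = g" | "g < z" "z < w" using xz by linarith
      then show ?thesis
      proof cases
        case 1
        have G_le: "G u \<le> z" for u
          unfolding 1 cdf_def by (intro finite_measure_mono) auto
        have "AE u in M. u \<in> - A \<longrightarrow> - c - (- q u) \<le> 0"
          using A_le by eventually_elim (use G_le in \<open>auto simp: lev_def\<close>)
        then have "f (- c) \<le> 0 * measure M (- A)"
          unfolding fc by (intro set_integral_le_const) (use q in auto)
        moreover have "f (- t) \<le> f (- c)"
          unfolding f_def using True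
          by (intro integral_mono m.integrable_put) (use im in auto)
        moreover have "0 \<le> (LINT u:- A|M. max 0 (- t - (- q u)))"
          unfolding set_lebesgue_integral_def by (intro Bochner_Integration.integral_nonneg) auto
        ultimately show ?thesis by simp
      next
        case 2
        then show ?thesis by (intro bound[of c]) (use AE_le_c AE_ge_c in auto)
      next
        case 3
        obtain a where a: "a \<in> {0<..<1}" "G a = z" "AE u in M. G u \<le> z \<longrightarrow> q u \<le> q a"
          "AE u in M. z \<le> G u \<longrightarrow> q a \<le> q u"
          by (rule AE_threshold[of z]) (use 3 xz g in linarith)+
        show ?thesis
        proof (rule bound[of "q a"])
          show "c \<le> q a" using gt_g[of a] a 3 by simp
        qed (use a in auto)
      qed
    qed
    ultimately show ?thesis by simp
  next
    case False
    have "(LINT x:{c<..}|m. max 0 (x - t)) = (LINT x:{c<..}|m. - t - (- x))"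
      unfolding set_lebesgue_integral_def
      using False by (intro Bochner_Integration.integral_cong) (auto simp: indicator_def)
    also have "\<dots> = (LINT u:- A|M. - t - (- q u))"
      using m.set_integral_affine[of "\<lambda>x. - x" "{c<..}" "-t"] im q
        set_integral_affine[of "\<lambda>u. - q u" "- A" "-t"] meas_nA int_nA
      by (simp add: p'_def M2_def set_lebesgue_integral_def)
    also have "\<dots> \<le> (LINT u:- A|M. max 0 (- t - (- q u)))"
      using q by (intro set_integral_mono set_integrable_of_integrable integrable_put) auto
    finally show ?thesis by simp
  qed
  have "cx_below m {..c} M A q"
    using puts meas_A int_A by (simp add: cx_below_def p_def M1_def)
  \<comment> \<open>Put-call parity converts the comparison of calls back to puts.\<close>
  moreover have "cx_below m {c<..} M (- A) q"
    using calls meas_nA int_nA im q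
    by (simp add: cx_below_def p'_def M2_def m.set_integral_put_call set_integral_put_call)
  ultimately show ?thesis using A by blast
qed

end

section \<open>Iterating the split\<close>

lemma measure_density_indicator:
  assumes "S \<in> sets N" "T \<in> sets N"
  shows "measure (density N (indicator S)) T = measure N (S \<inter> T)"
  using assms by (simp add: measure_def emeasure_restricted)

lemma set_integral_density_indicator:
  fixes f :: "'a \<Rightarrow> real"
  assumes "f \<in> borel_measurable N" "S \<in> sets N" "T \<in> sets N"
  shows "(LINT u:T|density N (indicator S). f u) = (LINT u:S \<inter> T|N. f u)"
proof -
  note [measurable] = assms
  have "(LINT u:T|density N (\<lambda>u. ennreal (indicator S u)). f u) = (LINT u:S \<inter> T|N. f u)"
    unfolding set_lebesgue_integral_def
    by (subst integral_density) (auto intro!: Bochner_Integration.integral_cong simp: indicator_def)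
  then show ?thesis by (simp add: ennreal_indicator)
qed

lemma cx_below_density_indicator:
  assumes "sets \<mu> = sets borel" "q \<in> borel_measurable N"
    and "X \<in> sets borel" "X' \<in> sets borel" "E \<in> sets N" "E' \<in> sets N"
  shows "cx_below (density \<mu> (indicator X)) X' (density N (indicator E)) E' q \<longleftrightarrow>
    cx_below \<mu> (X \<inter> X') N (E \<inter> E') q"
proof -
  note [measurable] = assms(2-)
  note [measurable_cong, simp] = assms(1)
  show ?thesis
    by (simp add: cx_below_def measure_density_indicator set_integral_density_indicator assms)
qed

lemma threshold_code_borel:
  fixes c :: "nat \<Rightarrow> real"
  shows "{x. {i\<in>{..<n}. x \<le> c i} = s} \<in> sets borel"
proof -
  have "{x. {i\<in>{..<n}. x \<le> c i} = s} = {x. (\<forall>i\<in>{..<n}. x \<le> c i \<longleftrightarrow> i \<in> s) \<and> s \<subseteq> {..<n}}"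
    by auto
  then show ?thesis by simp
qed

lemma cx_below_empty: "cx_below \<mu> {} N {} q"
  by (simp add: cx_below_def set_lebesgue_integral_def)

text \<open>A Dynkin class argument for integrals in place of measures. \<open>UNIV \<in> G\<close>
  gives equal total integrals for the complement case, and integrability gives countable additivity.
  The integrand 1 yields equality of laws, and \<open>q\<close> against the identity yields the
  martingale property.\<close>

lemma set_integral_eq_of_generator:
  fixes f :: "'a \<Rightarrow> real" and f' :: "'b \<Rightarrow> real"
  assumes M: "finite_measure M" "integrable M f" "g \<in> measurable M (sigma UNIV G)"
    and M': "finite_measure M'" "integrable M' f'" "g' \<in> measurable M' (sigma UNIV G)"
    and G: "Int_stable G" "UNIV \<in> G"
    and eq: "\<And>S. S \<in> G \<Longrightarrow> (LINT u:g -` S \<inter> space M|M. f u) = (LINT x:g' -` S \<inter> space M'|M'. f' x)"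
    and S: "S \<in> sets (sigma UNIV G)"
  shows "(LINT u:g -` S \<inter> space M|M. f u) = (LINT x:g' -` S \<inter> space M'|M'. f' x)"
proof -
  interpret finite_measure M by (rule M)
  interpret M': finite_measure M' by (rule M')
  have s: "g -` S \<inter> space M \<in> sets M" "g' -` S \<inter> space M' \<in> sets M'"
    if "S \<in> sigma_sets UNIV G" for S
    using that M(3) M'(3) by (auto intro!: measurable_sets)
  have Gp: "G \<subseteq> Pow UNIV" by simp
  from S have "S \<in> sigma_sets UNIV G" by simp
  from G(1) Gp this show ?thesis
  proof (induction rule: sigma_sets_induct_disjoint)
    case (compl A)
    have v: "g -` (UNIV - A) \<inter> space M = space M - g -` A \<inter> space M"
      "g' -` (UNIV - A) \<inter> space M' = space M' - g' -` A \<inter> space M'" by auto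
    show ?case
      unfolding v
      using set_integral_split[OF M(2) s(1)[OF compl(1)] sets.top]
        M'.set_integral_split[OF M'(2) s(2)[OF compl(1)] sets.top] compl(2) eq[OF G(2)]
      by simp
  next
    case (union A)
    have v: "g -` (\<Union>i. A i) \<inter> space M = (\<Union>i. g -` A i \<inter> space M)"
      "g' -` (\<Union>i. A i) \<inter> space M' = (\<Union>i. g' -` A i \<inter> space M')" by auto
    have A: "A i \<in> sigma_sets UNIV G" for i using union by auto
    have "(LINT u:(\<Union>i. g -` A i \<inter> space M)|M. f u) = (\<Sum>i. LINT u:g -` A i \<inter> space M|M. f u)"
      using union(1) s(1)[OF A]
      by (intro lebesgue_integral_countable_add set_integrable_of_integrable M(2) sets.countable_UN)
        (fastforce simp: disjoint_family_on_def)+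
    moreover have "(LINT u:(\<Union>i. g' -` A i \<inter> space M')|M'. f' u)
        = (\<Sum>i. LINT u:g' -` A i \<inter> space M'|M'. f' u)"
      using union(1) s(2)[OF A]
      by (intro lebesgue_integral_countable_add M'.set_integrable_of_integrable M'(2)
          sets.countable_UN) (fastforce simp: disjoint_family_on_def)+
    ultimately show ?case unfolding v by (simp add: union)
  next
    case empty
    show ?case by (simp add: set_lebesgue_integral_def)
  qed (rule eq)
qed

section \<open>Refining the cells along a sequence of thresholds\<close>

context mono_quantile
begin

lemma mono_quantile_density:
  assumes E: "E \<in> sets borel"
  shows "mono_quantile (density M (indicator E)) q"
proof -
  interpret E: finite_measure "density M (indicator E)"
    using E by (intro finite_measure_restricted) simp
  show ?thesis
  proof
    show "measure (density M (indicator E)) {u} = 0" for u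
      using E finite_measure_mono[of "E \<inter> {u}" "{u}"] atomless[of u] measure_nonneg[of M "E \<inter> {u}"]
      by (simp add: measure_density_indicator)
    show "AE u in density M (indicator E). u \<in> {0<..<1}"
      using AE_unit E by (subst AE_density) (auto elim: eventually_mono)
    have "integrable (density M (\<lambda>u. ennreal (indicator E u))) q"
      using E integrable_mult_indicator[OF _ q, of E] by (subst integrable_density) simp_all
    then show "integrable (density M (indicator E)) q" by (simp add: ennreal_indicator)
  qed (use mono_q in auto)
qed

text \<open>Restricting both measures to their cells preserves all hypotheses of
  \<open>cx_below_split\<close>, with the cells in the role of the whole space.\<close>

lemma cx_below_split_cell:
  assumes m: "finite_borel_measure m" and im: "integrable m (\<lambda>x. x)"
    and XE: "X \<in> sets borel" "E \<in> sets borel" and below: "cx_below m X M E q"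
  shows "\<exists>A\<in>sets borel. cx_below m (X \<inter> {..c}) M (E \<inter> A) q \<and>
           cx_below m (X \<inter> {c<..}) M (E - A) q"
proof -
  interpret m: finite_borel_measure m by (rule m)
  have sets_m [simp, measurable_cong]: "sets m = sets borel" by (rule m.M_is_borel)
  interpret E: mono_quantile "density M (indicator E)" q by (intro mono_quantile_density XE)
  interpret mX: finite_measure "density m (indicator X)"
    using XE by (intro m.finite_measure_restricted) simp
  have "finite_borel_measure (density m (indicator X))" by standard simp
  moreover have "integrable (density m (\<lambda>x. ennreal (indicator X x))) (\<lambda>x. x)"
    using XE integrable_mult_indicator[OF _ im, of X] by (subst integrable_density) simp_all
  then have "integrable (density m (indicator X)) (\<lambda>x. x)" by (simp add: ennreal_indicator)
  moreover have "cx_below (density m (indicator X)) UNIV (density M (indicator E)) UNIV q"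
    using below XE by (subst cx_below_density_indicator) auto
  ultimately obtain A where A: "A \<in> sets borel"
    and "cx_below (density m (indicator X)) {..c} (density M (indicator E)) A q"
    and "cx_below (density m (indicator X)) {c<..} (density M (indicator E)) (- A) q"
    using E.cx_below_split[of "density m (indicator X)" c] by blast
  then show ?thesis
    using XE by (intro bexI[of _ A]) (auto simp: cx_below_density_indicator Diff_eq)
qed

text \<open>
  \<open>f u\<close> is the set of those \<open>i < n\<close> for which \<open>u\<close> lies in the part assigned to \<open>{..c i}\<close>.
\<close>
definition coded :: "real measure \<Rightarrow> (nat \<Rightarrow> real) \<Rightarrow> nat \<Rightarrow> (real \<Rightarrow> nat set) \<Rightarrow> bool" where
  "coded m c n f \<longleftrightarrow> (\<forall>u. f u \<subseteq> {..<n}) \<and> (\<forall>s. {u. f u = s} \<in> sets borel) \<and>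
     (\<forall>s. cx_below m {x. {i\<in>{..<n}. x \<le> c i} = s} M {u. f u = s} q)"

text \<open>Every cell is split at \<open>c n\<close>, and its lower part receives the new index
  \<open>n\<close>. Earlier indices are unchanged, which makes the codes of successive stages
  compatible.\<close>

lemma coded_step:
  assumes m: "finite_borel_measure m" and im: "integrable m (\<lambda>x. x)"
    and f: "coded m c n f"
  shows "\<exists>f'. coded m c (Suc n) f' \<and> (\<forall>u. f' u \<inter> {..<n} = f u)"
proof -
  define X where "X s = {x. {i\<in>{..<n}. x \<le> c i} = s}" for s
  have X [measurable]: "X s \<in> sets borel" for s
    unfolding X_def by (rule threshold_code_borel)
  have f1: "f u \<subseteq> {..<n}" and f2 [measurable]: "{u. f u = s} \<in> sets borel"
    and f3: "cx_below m (X s) M {u. f u = s} q" for u s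
    using f by (auto simp: coded_def X_def)
  have "\<exists>A. \<forall>s. A s \<in> sets borel \<and> cx_below m (X s \<inter> {..c n}) M ({u. f u = s} \<inter> A s) q \<and>
      cx_below m (X s \<inter> {c n<..}) M ({u. f u = s} - A s) q"
    by (intro choice allI) (use cx_below_split_cell[OF m im X f2 f3, of _ "c n"] in blast)
  then obtain A where A [measurable]: "\<And>s. A s \<in> sets borel"
    and le: "\<And>s. cx_below m (X s \<inter> {..c n}) M ({u. f u = s} \<inter> A s) q"
    and gt: "\<And>s. cx_below m (X s \<inter> {c n<..}) M ({u. f u = s} - A s) q" by metis
  define f' where "f' u = (if u \<in> A (f u) then insert n (f u) else f u)" for u
  have nf: "n \<notin> f u" for u using f1[of u] by auto
  \<comment> \<open>Membership of \<open>n\<close> in \<open>s\<close> tells which half of the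
    parent cell is meant, and the parent code is \<open>s\<close> without \<open>n\<close>.\<close>
  have f'_eq: "{u. f' u = s} =
      (if n \<in> s then {u. f u = s - {n}} \<inter> A (s - {n}) else {u. f u = s} - A s)" for s
    using nf by (auto simp: f'_def)
  have X'_eq: "{x. {i\<in>{..<Suc n}. x \<le> c i} = s} =
      (if n \<in> s then X (s - {n}) \<inter> {..c n} else X s \<inter> {c n<..})" for s
    unfolding X_def by (auto simp: less_Suc_eq not_le)
  have "coded m c (Suc n) f'"
    unfolding coded_def f'_eq X'_eq
  proof (intro conjI allI)
    show "f' u \<subseteq> {..<Suc n}" for u using f1[of u] by (auto simp: f'_def)
  qed (use le gt in auto)
  moreover have "\<forall>u. f' u \<inter> {..<n} = f u" using f1 by (force simp: f'_def)
  ultimately show ?thesis by blast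
qed

text \<open>Infinite codes on the two sides have the same law and the same cell means, since they
  agree on finite stages. A real number is determined by which rationals lie at or above it, so
  decoding the code of \<open>u\<close> yields \<open>f u\<close>.\<close>

theorem backward_map:
  assumes m: "finite_borel_measure m" and im: "integrable m (\<lambda>x. x)"
    and below: "cx_below m UNIV M UNIV q"
  shows "\<exists>f\<in>borel_measurable borel. distr M borel f = m \<and>
    (\<forall>S\<in>sets borel. (LINT u:f -` S|M. q u) = (LINT x:S|m. x))"
proof -
  interpret m: finite_borel_measure m by (rule m)
  have sets_m [simp, measurable_cong]: "sets m = sets borel" by (rule m.M_is_borel)
  have space_m [simp]: "space m = UNIV" by (rule m.borel_UNIV)
  define c :: "nat \<Rightarrow> real" where "c = from_nat_into \<rat>"
  have c: "range c = \<rat>" unfolding c_def by (intro range_from_nat_into) (auto simp: countable_rat)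
  have "\<exists>F. \<forall>n. coded m c n (F n) \<and> (\<forall>u. F (Suc n) u \<inter> {..<n} = F n u)"
  proof (rule dependent_nat_choice)
    have "coded m c 0 (\<lambda>_. {})"
      unfolding coded_def
    proof (intro conjI allI)
      fix s :: "nat set"
      \<comment> \<open>Before any cut the code \<open>{}\<close> carries the whole space and every
        other cell is empty.\<close>
      show "cx_below m {x. {i\<in>{..<0}. x \<le> c i} = s} M {u. {} = s} q"
        using below cx_below_empty by (cases "s = {}") auto
    qed auto
    then show "\<exists>f. coded m c 0 f" by blast
  qed (rule coded_step[OF m im])
  then obtain F where F: "\<And>n. coded m c n (F n)" and F_Suc: "\<And>n u. F (Suc n) u \<inter> {..<n} = F n u"
    by blast
  define code where "code u = (\<Union>n. F n u)" for u
  define code' where "code' x = {i. x \<le> c i}" for x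
  have F_sub: "F n u \<subseteq> {..<n}" for n u using F[of n] by (simp add: coded_def)
  have F_restr: "F (n + k) u \<inter> {..<n} = F n u" for n k u
  proof (induction k)
    case 0
    show ?case using F_sub[of n u] by auto
  next
    case (Suc k)
    have "F (n + Suc k) u \<inter> {..<n} = (F (Suc (n + k)) u \<inter> {..<n + k}) \<inter> {..<n}" by auto
    with Suc show ?case by (simp only: F_Suc)
  qed
  have code_restr: "code u \<inter> {..<n} = F n u" for u n
  proof
    show "code u \<inter> {..<n} \<subseteq> F n u"
    proof
      fix i assume "i \<in> code u \<inter> {..<n}"
      then obtain k where k: "i \<in> F k u" "i < n" by (auto simp: code_def)
      show "i \<in> F n u"
      proof (cases "k \<le> n")
        case True
        then show ?thesis using F_restr[of k "n - k" u] k by auto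
      next
        case False
        then show ?thesis using F_restr[of n "k - n" u] k by auto
      qed
    qed
    show "F n u \<subseteq> code u \<inter> {..<n}" using F_sub[of n u] by (auto simp: code_def)
  qed
  \<comment> \<open>These are the cylinder sets. Each pulls back to a finite union of cells of stage
    \<open>n\<close>, because only subsets of \<open>{..<n}\<close> matter in
    \<open>T\<close>.\<close>
  define \<G> :: "nat set set set" where "\<G> = {{b. b \<inter> {..<n} \<in> T} |n T. True}"
  have gen: "{b. b \<inter> {..<n} \<in> T} \<in> \<G>" for n T by (auto simp: \<G>_def)
  have "Int_stable \<G>"
  proof (rule Int_stableI)
    fix a b assume "a \<in> \<G>" "b \<in> \<G>"
    then obtain n T n' T' where ab: "a = {b. b \<inter> {..<n} \<in> T}" "b = {b. b \<inter> {..<n'} \<in> T'}"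
      by (auto simp: \<G>_def)
    have "b \<inter> {..<max n n'} \<inter> {..<n} = b \<inter> {..<n}" "b \<inter> {..<max n n'} \<inter> {..<n'} = b \<inter> {..<n'}"
      for b :: "nat set" by auto
    then have "a \<inter> b = {b. b \<inter> {..<max n n'} \<in> {s. s \<inter> {..<n} \<in> T \<and> s \<inter> {..<n'} \<in> T'}}"
      by (auto simp: ab)
    then show "a \<inter> b \<in> \<G>" by (simp only: gen)
  qed
  have "UNIV \<in> \<G>" using gen[of 0 UNIV] by simp
  have code_gen: "code -` {b. b \<inter> {..<n} \<in> T} = (\<Union>s\<in>T \<inter> Pow {..<n}. {u. F n u = s})" for n T
    using F_sub by (auto simp: code_restr)
  have code'_gen: "code' -` {b. b \<inter> {..<n} \<in> T} =
      (\<Union>s\<in>T \<inter> Pow {..<n}. {x. {i\<in>{..<n}. x \<le> c i} = s})" for n T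
  proof -
    have "code' x \<inter> {..<n} = {i\<in>{..<n}. x \<le> c i}" for x by (auto simp: code'_def)
    then show ?thesis by auto
  qed
  have F_sets [measurable]: "{u. F n u = s} \<in> sets borel" for n s
    using F[of n] by (simp add: coded_def)
  have cell: "cx_below m {x. {i\<in>{..<n}. x \<le> c i} = s} M {u. F n u = s} q" for n s
    using F[of n] by (simp add: coded_def)
  have code_sets: "code -` {b. b \<inter> {..<n} \<in> T} \<in> sets borel"
    "code' -` {b. b \<inter> {..<n} \<in> T} \<in> sets borel" for n T
    unfolding code_gen code'_gen by (intro sets.finite_UN threshold_code_borel F_sets; simp)+
  have code_meas: "code \<in> measurable M (sigma UNIV \<G>)"
    by (rule measurable_measure_of) (use code_sets in \<open>auto simp: \<G>_def\<close>)
  have code'_meas: "code' \<in> measurable m (sigma UNIV \<G>)"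
    by (rule measurable_measure_of) (use code_sets in \<open>auto simp: \<G>_def\<close>)
  have law: "measure M (code -` S) = measure m (code' -` S)"
    "(LINT u:code -` S|M. q u) = (LINT x:code' -` S|m. x)" if "S \<in> sets (sigma UNIV \<G>)" for S
  proof -
    have "(LINT u:code -` S \<inter> space M|M. 1 :: real) = (LINT x:code' -` S \<inter> space m|m. 1)"
    proof (rule set_integral_eq_of_generator[OF _ _ code_meas _ _ code'_meas
          \<open>Int_stable \<G>\<close> \<open>UNIV \<in> \<G>\<close> _ that])
      fix S assume "S \<in> \<G>"
      then obtain n T where S: "S = {b. b \<inter> {..<n} \<in> T}" by (auto simp: \<G>_def)
      have "measure M (code -` S) = (\<Sum>s\<in>T \<inter> Pow {..<n}. measure M {u. F n u = s})"
        unfolding S code_gen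
        by (intro finite_measure_finite_Union) (auto simp: disjoint_family_on_def)
      also have "\<dots> = (\<Sum>s\<in>T \<inter> Pow {..<n}. measure m {x. {i\<in>{..<n}. x \<le> c i} = s})"
        using cell by (simp add: cx_below_def)
      also have "\<dots> = measure m (code' -` S)"
        unfolding S code'_gen
        by (intro m.finite_measure_finite_Union[symmetric])
          (auto simp: disjoint_family_on_def intro!: threshold_code_borel[simplified])
      finally show "(LINT u:code -` S \<inter> space M|M. 1 :: real) = (LINT x:code' -` S \<inter> space m|m. 1)"
        by (simp add: set_lebesgue_integral_def)
    qed (unfold_locales, simp_all)
    then show "measure M (code -` S) = measure m (code' -` S)"
      by (simp add: set_lebesgue_integral_def)
  next
    have "(LINT u:code -` S \<inter> space M|M. q u) = (LINT x:code' -` S \<inter> space m|m. x)"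
    proof (rule set_integral_eq_of_generator[OF _ q code_meas _ im code'_meas
          \<open>Int_stable \<G>\<close> \<open>UNIV \<in> \<G>\<close> _ that])
      fix S assume "S \<in> \<G>"
      then obtain n T where S: "S = {b. b \<inter> {..<n} \<in> T}" by (auto simp: \<G>_def)
      have "(LINT u:code -` S|M. q u) = (\<Sum>s\<in>T \<inter> Pow {..<n}. LINT u:{u. F n u = s}|M. q u)"
        unfolding S code_gen
        by (intro set_integral_finite_Union set_integrable_of_integrable q)
          (auto simp: disjoint_family_on_def)
      also have "\<dots> = (\<Sum>s\<in>T \<inter> Pow {..<n}. LINT x:{x. {i\<in>{..<n}. x \<le> c i} = s}|m. x)"
        using cell by (simp add: cx_below_def)
      also have "\<dots> = (LINT x:code' -` S|m. x)"
        unfolding S code'_gen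
        by (intro set_integral_finite_Union[symmetric] m.set_integrable_of_integrable im)
          (auto simp: disjoint_family_on_def intro!: threshold_code_borel[simplified])
      finally show "(LINT u:code -` S \<inter> space M|M. q u) = (LINT x:code' -` S \<inter> space m|m. x)"
        by simp
    qed unfold_locales
    then show "(LINT u:code -` S|M. q u) = (LINT x:code' -` S|m. x)" by simp
  qed
  \<comment> \<open>The decoder takes the infimum of the thresholds in the code; by density of the
    rationals it inverts \<open>code'\<close>. An infinite infimum, possible for other codes, is
    sent to 0.\<close>
  define \<psi> where "\<psi> b = real_of_ereal (INF i. if i \<in> b then ereal (c i) else \<infinity>)" for b
  have pred [measurable]: "Measurable.pred (sigma UNIV \<G>) (\<lambda>b. i \<in> b)" for i
  proof -
    have "{b. i \<in> b} = {b. b \<inter> {..<Suc i} \<in> {s. i \<in> s}}" by auto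
    also have "\<dots> \<in> sigma_sets UNIV \<G>" by (intro sigma_sets.Basic gen)
    finally show ?thesis by (simp add: pred_def space_measure_of_conv)
  qed
  have psi [measurable]: "\<psi> \<in> borel_measurable (sigma UNIV \<G>)"
    unfolding \<psi>_def by measurable
  have psi_code': "\<psi> (code' x) = x" for x
  proof -
    have "(INF i. if i \<in> code' x then ereal (c i) else \<infinity>) = ereal x"
    proof (rule INF_eqI)
      show "ereal x \<le> (if i \<in> code' x then ereal (c i) else \<infinity>)" for i
        by (auto simp: code'_def)
      fix y assume y: "\<And>i. i \<in> UNIV \<Longrightarrow> y \<le> (if i \<in> code' x then ereal (c i) else \<infinity>)"
      show "y \<le> ereal x"
      proof (rule ccontr)
        assume "\<not> y \<le> ereal x"
        then have "ereal x < y" by simp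
        then obtain r where r: "x < r" "ereal r < y" using ereal_dense2[of "ereal x" y] by auto
        obtain d where d: "d \<in> \<rat>" "x < d" "d < r" using Rats_dense_in_real[of x r] r by auto
        then obtain i where "c i = d" using c by (metis imageE)
        then have "y \<le> ereal d" using y[of i] d by (simp add: code'_def)
        also have "ereal d < ereal r" using d by simp
        finally show False using r by simp
      qed
    qed
    then show ?thesis by (simp add: \<psi>_def)
  qed
  define f where "f u = \<psi> (code u)" for u
  have f [measurable]: "f \<in> borel_measurable borel"
    using measurable_comp[OF code_meas psi] by (simp add: f_def[abs_def] comp_def cong: measurable_cong_sets)
  have vim: "f -` S = code -` (\<psi> -` S)" "code' -` (\<psi> -` S) = S" for S
    by (auto simp: f_def psi_code')
  have S: "\<psi> -` S \<in> sets (sigma UNIV \<G>)" if "S \<in> sets borel" for S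
    using measurable_sets[OF psi that] by (simp add: space_measure_of_conv)
  have "distr M borel f = m"
  proof (rule measure_eqI)
    fix S assume "S \<in> sets (distr M borel f)"
    then have [measurable]: "S \<in> sets borel" by simp
    have "measure M (f -` S) = measure m S"
      using law(1)[OF S[OF \<open>S \<in> sets borel\<close>]] by (simp only: vim)
    then show "emeasure (distr M borel f) S = emeasure m S"
      by (simp add: emeasure_distr emeasure_eq_measure m.emeasure_eq_measure)
  qed simp
  moreover have "(LINT u:f -` S|M. q u) = (LINT x:S|m. x)" if "S \<in> sets borel" for S
    using law(2)[OF S[OF that]] by (simp only: vim)
  ultimately show ?thesis using f by blast
qed

end

section \<open>The transport\<close>

text \<open>\<open>q\<close> is the generalised inverse of the distribution function under Lebesgue
  measure on the unit interval. The inverse relation always gives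
  \<open>u \<le> cdf \<nu> (q u)\<close>; off atoms, left continuity gives the reverse
  inequality.\<close>

lemma quantile_representation:
  assumes "real_distribution \<nu>" and i\<nu>: "integrable \<nu> (\<lambda>x. x)"
  obtains L q where "mono_quantile L q" "prob_space L" "distr L borel q = \<nu>"
    "AE u in L. measure \<nu> {q u} = 0 \<longrightarrow> cdf \<nu> (q u) = u"
proof -
  interpret cdf_distribution \<nu> using assms by (simp add: cdf_distribution_def)
  define L :: "real measure" where "L = density lborel (indicator {0<..<1})"
  \<comment> \<open>The value 0 outside the unit interval only makes \<open>q\<close> total; those
    points are null for \<open>L\<close>.\<close>
  define q where "q u = (if u \<in> {0<..<1} then I u else 0)" for u
  have [simp, measurable_cong]: "sets L = sets borel" and [simp]: "space L = UNIV"
    by (simp_all add: L_def)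
  have q [measurable]: "q \<in> borel_measurable borel"
    unfolding q_def using measurable_CI by (subst (asm) measurable_restrict_space_iff) auto
  have emeas: "emeasure L S = emeasure lborel ({0<..<1} \<inter> S)" if "S \<in> sets borel" for S
    using that by (simp add: L_def emeasure_restricted)
  have L: "prob_space L" by (rule prob_spaceI) (simp add: emeas)
  interpret L: prob_space L by (rule L)
  have distr: "distr L borel q = \<nu>"
  proof (rule measure_eqI)
    fix S assume "S \<in> sets (distr L borel q)"
    then have [measurable]: "S \<in> sets borel" by simp
    have "emeasure \<nu> S = emeasure (distr (restrict_space lborel {0<..<1}) borel I) S"
      by (simp only: distr_I_eq_M)
    also have "\<dots> = emeasure lborel (I -` S \<inter> {0<..<1})"
      using measurable_sets[OF measurable_CI, of S]
      by (subst emeasure_distr)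
        (auto simp: emeasure_restrict_space space_restrict_space sets_restrict_space cong: measurable_cong_sets)
    also have "I -` S \<inter> {0<..<1} = {0<..<1} \<inter> q -` S" by (auto simp: q_def)
    also have "emeasure lborel \<dots> = emeasure (distr L borel q) S"
      by (simp add: emeasure_distr emeas measurable_sets_borel[OF q])
    finally show "emeasure (distr L borel q) S = emeasure \<nu> S" by simp
  qed simp
  have AE: "AE u in L. u \<in> {0<..<1}"
    unfolding L_def by (subst AE_density) (auto simp: indicator_def)
  have "mono_quantile L q"
  proof
    show "measure L {u} = 0" for u
      using emeasure_mono[of "{0<..<1} \<inter> {u}" "{u}" lborel] by (simp add: measure_def emeas)
    show "integrable L q"
      using i\<nu> unfolding distr[symmetric] by (subst (asm) integrable_distr_eq) simp_all
    show "mono_on {0<..<1} q"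
      using mono_I by (auto simp: mono_on_def q_def)
  qed (use AE in auto)
  moreover have "AE u in L. measure \<nu> {q u} = 0 \<longrightarrow> cdf \<nu> (q u) = u"
    using AE
  proof (rule eventually_mono, intro impI)
    fix u assume u: "u \<in> {0<..<1}" and a: "measure \<nu> {q u} = 0"
    have ps: "u \<le> C x \<longleftrightarrow> q u \<le> x" for x using u pseudoinverse[of u x] by (simp add: q_def)
    have "C (q u) \<le> u"
    proof (rule tendsto_upperbound)
      show "(C \<longlongrightarrow> C (q u)) (at_left (q u))"
        using a isCont_cdf[of "q u"] by (auto simp: isCont_def intro: tendsto_within_subset)
      have "C x \<le> u" if "x < q u" for x using ps[of x] that by linarith
      then show "\<forall>\<^sub>F x in at_left (q u). C x \<le> u"
        by (simp add: eventually_at_filter)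
    qed simp
    with ps[of "q u"] show "C (q u) = u" by simp
  qed
  ultimately show ?thesis using L distr that by blast
qed

text \<open>Puts are convex, and so are the identity and its negative, which forces equal means. All
  of these are integrable, so the extended integral is the ordinary one.\<close>

lemma convex_order_imp_cx_below:
  assumes \<mu>: "\<mu> \<in> P1" and \<nu>: "\<nu> \<in> P1" and le: "\<mu> \<le>\<^sub>c\<^sub>x \<nu>"
    and L: "prob_space L" and q: "q \<in> borel_measurable L" and distr: "distr L borel q = \<nu>"
  shows "cx_below \<mu> UNIV L (space L) q"
proof -
  interpret \<mu>: prob_space \<mu> using \<mu> by (simp add: P1_def)
  interpret \<nu>: prob_space \<nu> using \<nu> by (simp add: P1_def)
  interpret L: prob_space L by (rule L)
  have i: "integrable \<mu> (\<lambda>x. x)" "integrable \<nu> (\<lambda>x. x)" using \<mu> \<nu> by (auto simp: P1_def)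
  have "space \<mu> = UNIV" using \<mu> sets_eq_imp_space_eq[of \<mu> borel] by (simp add: P1_def)
  have mono: "(\<integral>x. \<phi> x \<partial>\<mu>) \<le> (\<integral>x. \<phi> x \<partial>\<nu>)"
    if "convex_on UNIV \<phi>" "integrable \<mu> \<phi>" "integrable \<nu> \<phi>" for \<phi>
    using le that by (auto simp: convex_order_def ext_integral_eq_integral)
  have to_L: "(\<integral>x. \<phi> x \<partial>\<nu>) = (LINT u:space L|L. \<phi> (q u))" if "\<phi> \<in> borel_measurable borel" for \<phi> :: "real \<Rightarrow> real"
    unfolding distr[symmetric] set_lebesgue_integral_def using q that
    by (auto simp: integral_distr intro!: Bochner_Integration.integral_cong)
  have "(\<integral>x. x \<partial>\<mu>) = (\<integral>x. x \<partial>\<nu>)"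
    using mono[of "\<lambda>x. x"] mono[of "\<lambda>x. - x"] i
    by (auto simp: convex_on_def algebra_simps)
  moreover have "(\<integral>x. max 0 (t - x) \<partial>\<mu>) \<le> (\<integral>x. max 0 (t - x) \<partial>\<nu>)" for t
  proof (rule mono)
    show "convex_on UNIV (\<lambda>x. max 0 (t - x))"
    proof (rule convex_onI)
      fix s x y :: real assume s: "0 < s" "s < 1"
      have "t - ((1 - s) *\<^sub>R x + s *\<^sub>R y) = (1 - s) * (t - x) + s * (t - y)"
        by (simp add: algebra_simps)
      also have "\<dots> \<le> (1 - s) * max 0 (t - x) + s * max 0 (t - y)"
        using s by (intro add_mono mult_left_mono) auto
      finally show "max 0 (t - ((1 - s) *\<^sub>R x + s *\<^sub>R y))
          \<le> (1 - s) * max 0 (t - x) + s * max 0 (t - y)"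
        using s by simp
    qed simp
  qed (use i in \<open>auto intro!: \<mu>.integrable_put \<nu>.integrable_put\<close>)
  ultimately show ?thesis
    using \<mu>.prob_space \<open>space \<mu> = UNIV\<close> to_L[of "\<lambda>x. x"] to_L[of "\<lambda>x. max 0 (t - x)" for t]
    by (simp add: cx_below_def L.prob_space set_lebesgue_integral_def)
qed

lemma martingale_transport_of_map:
  fixes f q :: "real \<Rightarrow> real"
  assumes L: "prob_space L" and sets_L: "sets L = sets borel"
    and f [measurable]: "f \<in> borel_measurable borel" and q [measurable]: "q \<in> borel_measurable borel"
    and fi: "integrable L f" and qi: "integrable L q"
    and mart: "\<And>S. S \<in> sets borel \<Longrightarrow> (LINT u:f -` S|L. q u) = (LINT u:f -` S|L. f u)"
  shows "distr L borel (\<lambda>u. (f u, q u)) \<in> martingale_transports (distr L borel f) (distr L borel q)"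
proof -
  interpret L: prob_space L by (rule L)
  note sets_L [measurable_cong, simp]
  define \<pi> where "\<pi> = distr L borel (\<lambda>u. (f u, q u))"
  have fq [measurable]: "(\<lambda>u. (f u, q u)) \<in> measurable L borel"
    by (simp add: borel_prod[symmetric])
  have fst_m [measurable]: "fst \<in> borel_measurable (borel :: (real \<times> real) measure)"
    and snd_m [measurable]: "snd \<in> borel_measurable (borel :: (real \<times> real) measure)"
    by (simp_all add: borel_prod[symmetric])
  interpret \<pi>: prob_space \<pi> unfolding \<pi>_def by (rule L.prob_space_distr) simp
  define \<F> where "\<F> = vimage_algebra UNIV (fst :: real \<times> real \<Rightarrow> real) borel"
  have sub: "subalgebra \<pi> \<F>"
    by (auto simp: subalgebra_def \<pi>_def \<F>_def sets_vimage_algebra2 intro: measurable_sets_borel[OF fst_m])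
  interpret finite_measure_subalgebra \<pi> \<F> by standard (rule sub)
  have int: "integrable \<pi> snd" "integrable \<pi> fst"
    unfolding \<pi>_def using fi qi by (simp_all add: integrable_distr_eq)
  have "AE z in \<pi>. real_cond_exp \<pi> \<F> snd z = fst z"
  proof (rule real_cond_exp_charact)
    fix A assume "A \<in> sets \<F>"
    then obtain S where S [measurable]: "S \<in> sets borel" and A: "A = fst -` S"
      by (auto simp: \<F>_def sets_vimage_algebra2)
    have A_m [measurable]: "A \<in> sets borel" unfolding A by (rule measurable_sets_borel[OF fst_m S])
    have red: "(LINT z:A|\<pi>. k z) = (LINT u:f -` S|L. k (f u, q u))"
      if [measurable]: "k \<in> borel_measurable borel" for k :: "real \<times> real \<Rightarrow> real"
      unfolding \<pi>_def set_lebesgue_integral_def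
      by (subst integral_distr) (auto simp: A indicator_def intro!: Bochner_Integration.integral_cong)
    show "(LINT z:A|\<pi>. snd z) = (LINT z:A|\<pi>. fst z)"
      using mart[OF S] red[OF snd_m] red[OF fst_m] by simp
  next
    show "fst \<in> borel_measurable \<F>" unfolding \<F>_def by (rule measurable_vimage_algebra1) auto
  qed (fact int)+
  then show ?thesis
    unfolding martingale_transports_def \<pi>_def[symmetric]
    using \<pi>.prob_space_axioms
    by (auto simp: \<F>_def) (auto simp: \<pi>_def distr_distr comp_def)
qed

theorem theorem2p1:
  fixes \<mu> \<nu> :: "real measure"
  assumes "\<mu> \<in> P1" and "\<nu> \<in> P1"
    and "\<mu> \<le>\<^sub>c\<^sub>x \<nu>"
  shows "\<exists>\<pi> \<in> martingale_transports \<mu> \<nu>. \<exists>h \<in> borel_measurable borel.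
           measure \<pi> (T_rg h \<union> T_atom \<nu>) = 1 \<and>
           (atomless \<nu> \<longrightarrow> \<pi> \<in> monge_martingale_transports \<mu> \<nu>)"
proof -
  have rd: "real_distribution \<mu>" "real_distribution \<nu>"
    using assms by (auto simp: P1_def real_distribution_def real_distribution_axioms_def)
  interpret \<mu>: real_distribution \<mu> by (fact rd)
  interpret \<nu>: real_distribution \<nu> by (fact rd)
  have i: "integrable \<mu> (\<lambda>x. x)" "integrable \<nu> (\<lambda>x. x)" using assms by (auto simp: P1_def)
  obtain L q where Lq: "mono_quantile L q" and L: "prob_space L" and distr_q: "distr L borel q = \<nu>"
    and cdf_q: "AE u in L. measure \<nu> {q u} = 0 \<longrightarrow> cdf \<nu> (q u) = u"
    using quantile_representation[OF rd(2) i(2)] by blast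
  interpret mono_quantile L q by (rule Lq)
  interpret L: prob_space L by (rule L)
  have "cx_below \<mu> UNIV L UNIV q"
    using convex_order_imp_cx_below[OF assms L _ distr_q] by simp
  then obtain f where f [measurable]: "f \<in> borel_measurable borel" and distr_f: "distr L borel f = \<mu>"
    and mart: "\<And>S. S \<in> sets borel \<Longrightarrow> (LINT u:f -` S|L. q u) = (LINT x:S|\<mu>. x)"
    using backward_map[OF \<mu>.finite_borel_measure_M i(1)] by blast
  define \<pi> where "\<pi> = distr L borel (\<lambda>u. (f u, q u))"
  \<comment> \<open>Off the atoms of \<open>\<nu>\<close> the parameter \<open>u\<close> is
    recovered from \<open>y = q u\<close> as \<open>cdf \<nu> y\<close>, so there the first
    coordinate is a function of the second.\<close>
  define h where "h y = f (cdf \<nu> y)" for y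
  have cdf_m [measurable]: "cdf \<nu> \<in> borel_measurable borel"
    by (intro borel_measurable_mono monoI \<nu>.cdf_nondecreasing)
  have h [measurable]: "h \<in> borel_measurable borel" unfolding h_def by measurable
  have fq [measurable]: "(\<lambda>u. (f u, q u)) \<in> measurable borel borel"
    by (simp add: borel_prod[symmetric])
  have "\<pi> \<in> martingale_transports \<mu> \<nu>"
    unfolding \<pi>_def distr_f[symmetric] distr_q[symmetric]
  proof (rule martingale_transport_of_map[OF L sets_M f q_meas _ q])
    show "integrable L f"
      using i(1) unfolding distr_f[symmetric] by (subst (asm) integrable_distr_eq) simp_all
    fix S :: "real set" assume S [measurable]: "S \<in> sets borel"
    have "(LINT x:S|\<mu>. x) = (LINT u:f -` S|L. f u)"
      unfolding distr_f[symmetric] set_lebesgue_integral_def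
      by (subst integral_distr) (auto simp: indicator_def intro!: Bochner_Integration.integral_cong)
    with mart[OF S] show "(LINT u:f -` S|L. q u) = (LINT u:f -` S|L. f u)" by simp
  qed
  moreover have "measure \<pi> (T_rg h \<union> T_atom \<nu>) = 1"
  proof -
    interpret \<pi>: prob_space \<pi> unfolding \<pi>_def by (rule L.prob_space_distr) simp
    \<comment> \<open>A finite measure has only countably many atoms, which makes
      \<open>T_atom \<nu>\<close> Borel.\<close>
    have "countable {y. measure \<nu> {y} > 0}"
      using \<nu>.countable_support by (simp add: zero_less_measure_iff)
    then have [measurable]: "{y. measure \<nu> {y} > 0} \<in> sets borel"
      by (rule sets.countable[rotated]) simp
    define D where "D = T_rg h \<union> T_atom \<nu>"
    have D: "D = {z. fst z = h (snd z) \<or> snd z \<in> {y. measure \<nu> {y} > 0}}"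
      by (auto simp: D_def T_rg_def T_atom_def)
    have "Measurable.pred (borel \<Otimes>\<^sub>M borel)
        (\<lambda>z :: real \<times> real. fst z = h (snd z) \<or> snd z \<in> {y. measure \<nu> {y} > 0})"
      by measurable
    then have D_m: "D \<in> sets borel"
      unfolding D borel_prod by (simp add: pred_def)
    have "AE z in \<pi>. z \<in> D"
      unfolding \<pi>_def
    proof (subst AE_distr_iff)
      show "AE u in L. (f u, q u) \<in> D"
        using cdf_q
      proof eventually_elim
        case (elim u)
        then show ?case
          by (cases "measure \<nu> {q u} = 0") (auto simp: D h_def zero_less_measure_iff)
      qed
    qed (use D_m in simp_all)
    then show ?thesis
      using D_m unfolding D_def[symmetric] by (subst \<pi>.prob_eq_1) (auto simp: \<pi>_def)
  qed
  moreover have "\<pi> = distr \<nu> borel (\<lambda>y. (h y, y))" if "atomless \<nu>"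
  proof -
    have hy: "(\<lambda>y. (h y, y)) \<in> measurable borel borel" by (simp add: borel_prod[symmetric])
    have "distr \<nu> borel (\<lambda>y. (h y, y)) = distr L borel (\<lambda>u. (h (q u), q u))"
      unfolding distr_q[symmetric] using hy by (subst distr_distr) (auto simp: comp_def)
    also have "\<dots> = \<pi>"
      unfolding \<pi>_def
    proof (rule distr_cong_AE)
      show "AE u in L. (h (q u), q u) = (f u, q u)"
        using cdf_q by eventually_elim (use that in \<open>simp add: h_def atomless_def\<close>)
    qed (auto simp: borel_prod[symmetric])
    finally show ?thesis ..
  qed
  ultimately show ?thesis
    using h by (intro bexI[of _ \<pi>] bexI[of _ h]) (auto simp: monge_martingale_transports_def)
qed

end
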